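(* Let $\{a_n\}_{n\ge1}$, $\{b_n\}_{n\ge1}$ be the sequences attached to a pair $\{p,q\}$ of integers $p,q\ge4$ with $\{p,q\}\ne\{4,4\},\{4,5\}$ (ordered pairs), and let $\{\tilde a_n\}_{n\ge1}$, $\{\tilde b_n\}_{n\ge1}$ be the sequences attached to $\{4,5\}$, as defined in the context. Let $\mathbb{N}=\{0,1,2,\dots\}$ and $\mathbb{N}^+=\{1,2,3,\dots\}$. 1. All the solutions to $a_2=\tilde a_\ell$ with $5\le q\le 25$ (where $q$ is fixed, and $p$ and $\ell\ge1$ are the unknowns, $p$ being determined by $q$ and $\ell$) are given by - $q=5$, $\ell=2+2t$ ($t\in\mathbb{N}^+$); - $q=19$, $\ell=58+90t$ and $\ell=78+90t$ ($t\in\mathbb{N}$); - $q=23$, $\ell=28+88t$ ($t\in\mathbb{N}$); - $q=25$, $\ell=32+33t$ ($t\in\mathbb{N}$). 2. All the solutions to $b_1=\tilde b_\ell$ with $5\le q\le 25$ (where $q$ is fixed, and $p$ and $\ell\ge1$ are the unknowns, $p$ being determined by $q$ and $\ell$) are given by - $q=9$, $\ell=5+18t$ and $\ell=14+18t$ ($t\in\mathbb{N}$); - $q=11$, $\ell=3+10t$ and $\ell=8+10t$ ($t\in\mathbb{N}$); - $q=15$, $\ell=2+6t$ and $\ell=5+6t$ ($t\in\mathbb{N}$); - $q=17$, $\ell=5+18t$ and $\ell=14+18t$ ($t\in\mathbb{N}$).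
   Context: For integers $p\ge4$, $q\ge4$ with $(p-2)(q-2)>4$, the symbol $\{p,q\}$ (an ordered pair, the Schläfli symbol) denotes a regular mosaic of the hyperbolic plane. To it are attached two integer sequences $\{a_n\}_{n\ge1}$ and $\{b_n\}_{n\ge1}$ (numbers of tree roots and of the other vertices on level $n$ of a graph built from the mosaic), which are given by $a_1=q$, $b_1=(p-3)q$ and, for $n\ge2$, $$a_n=(q-3)a_{n-1}+(q-2)b_{n-1},$$ $$b_n=\big((q-3)(p-3)-1\big)a_{n-1}+\big((q-2)(p-3)-1\big)b_{n-1}.$$ Equivalently, with $\kappa=(p-2)(q-2)-2$, one has $a_1=q$, $a_2=(\kappa+1)q$, $b_1=(p-3)q$, $b_2=(\kappa(p-3)-1)q$, and $a_n=\kappa a_{n-1}-a_{n-2}$, $b_n=\kappa b_{n-1}-b_{n-2}$ for $n\ge3$. In particular $a_2=q(q-2)(p-2)-q$. The sequences attached to $\{4,5\}$ are denoted $\tilde a_n$, $\tilde b_n$; thus $\tilde a_1=5$, $\tilde a_2=25$, $\tilde a_n=4\tilde a_{n-1}-\tilde a_{n-2}$ and $\tilde b_1=5$, $\tilde b_2=15$, $\tilde b_n=4\tilde b_{n-1}-\tilde b_{n-2}$ for $n\ge3$.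
   Formalization: In part 2 the family q=5, ℓ=2+t (t∈ℕ) is added to the list of solutions: the list as printed omits q=5, although for instance {6,5} with ℓ=2 gives b_1=15=b̃_2. *)

theory Defs
  imports Main
begin

text \<open>The sequences are indexed from 1 as in the mathematics; the values at index 0 are dummies.\<close>

fun mosaic_a :: "int \<Rightarrow> int \<Rightarrow> nat \<Rightarrow> int"
  and mosaic_b :: "int \<Rightarrow> int \<Rightarrow> nat \<Rightarrow> int" where
  "mosaic_a p q 0 = 0"
| "mosaic_a p q (Suc 0) = q"
| "mosaic_a p q (Suc (Suc n)) =
     (q - 3) * mosaic_a p q (Suc n) + (q - 2) * mosaic_b p q (Suc n)"
| "mosaic_b p q 0 = 0"
| "mosaic_b p q (Suc 0) = (p - 3) * q"
| "mosaic_b p q (Suc (Suc n)) =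
     ((q - 3) * (p - 3) - 1) * mosaic_a p q (Suc n)
     + ((q - 2) * (p - 3) - 1) * mosaic_b p q (Suc n)"

text \<open>For p, q at least 4 the hyperbolicity condition (p - 2)(q - 2) > 4 excludes exactly (4,4).\<close>

definition admissible :: "int \<Rightarrow> int \<Rightarrow> bool" where
  "admissible p q \<longleftrightarrow> 4 \<le> p \<and> 4 \<le> q \<and> (p, q) \<noteq> (4, 4) \<and> (p, q) \<noteq> (4, 5)"

abbreviation a_tilde :: "nat \<Rightarrow> int" where "a_tilde \<equiv> mosaic_a 4 5"
abbreviation b_tilde :: "nat \<Rightarrow> int" where "b_tilde \<equiv> mosaic_b 4 5"

lemma mosaic_a_2: "mosaic_a p q 2 = q * (q - 2) * (p - 2) - q"
  by (simp add: numeral_2_eq_2 algebra_simps)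

lemma mosaic_recurrence:
  fixes p q :: int
  defines "\<kappa> \<equiv> (p - 2) * (q - 2) - 2"
  assumes "n \<ge> 3"
  shows "mosaic_a p q n = \<kappa> * mosaic_a p q (n - 1) - mosaic_a p q (n - 2)"
    and "mosaic_b p q n = \<kappa> * mosaic_b p q (n - 1) - mosaic_b p q (n - 2)"
proof -
  define m where "m = n - 3"
  have m: "n = Suc (Suc (Suc m))"
    unfolding m_def using \<open>n \<ge> 3\<close> by arith
  have sub: "n - 1 = Suc (Suc m)" "n - 2 = Suc m"
    by (simp_all add: m)
  show "mosaic_a p q n = \<kappa> * mosaic_a p q (n - 1) - mosaic_a p q (n - 2)"
    unfolding sub \<kappa>_def unfolding m mosaic_a.simps mosaic_b.simps by algebra
  show "mosaic_b p q n = \<kappa> * mosaic_b p q (n - 1) - mosaic_b p q (n - 2)"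
    unfolding sub \<kappa>_def unfolding m mosaic_a.simps mosaic_b.simps by algebra
qed

text \<open>Every term of the second sequence of (4,5) is divisible by 5, so q = 5 contributes
  solutions of b_1 = b_tilde l for every l > 1; the smallest one is the following.\<close>

lemma b_solution_q_5: "admissible 6 5 \<and> mosaic_b 6 5 1 = b_tilde 2"
  by (simp add: admissible_def numeral_2_eq_2)

end

(* For fixed q the equation a_2 = a_tilde l is linear in p, so it is solvable exactly when
   q (q - 2) divides a_tilde l + q and the resulting p is large enough; similarly b_1 = b_tilde l
   needs q to divide b_tilde l. Modulo m the pair (a_tilde, b_tilde) evolves under an invertible
   linear map and is therefore periodic, so each divisibility condition is settled by inspecting
   one period. Exponential growth of the sequences takes care of the size of p. *)

theory Submission
  imports Defs
begin

section \<open>The sequences of {4,5} modulo \<open>m\<close>\<close>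

definition tilde_step :: "int \<Rightarrow> int \<times> int \<Rightarrow> int \<times> int" where
  "tilde_step m = (\<lambda>(a, b). ((2 * a + 3 * b) mod m, (a + 2 * b) mod m))"

text \<open>The pair \<open>(-5, 5)\<close> is the extension of the recurrence to level 0, where \<open>a_tilde\<close> and
  \<open>b_tilde\<close> only have dummy values. Starting there, levels can be reduced modulo the period.\<close>

definition tilde_state :: "int \<Rightarrow> nat \<Rightarrow> int \<times> int" where
  "tilde_state m n = (tilde_step m ^^ n) (- 5 mod m, 5 mod m)"

text \<open>A single pass carries the current state along, so evaluation does not restart from level
  0 for every index.\<close>

primrec scan :: "int \<Rightarrow> (int \<times> int \<Rightarrow> bool) \<Rightarrow> nat \<Rightarrow> (int \<times> int) \<times> nat list" where
  "scan m P 0 = ((- 5 mod m, 5 mod m), [])"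
| "scan m P (Suc n) =
     (case scan m P n of (s, ns) \<Rightarrow> (tilde_step m s, if P s then n # ns else ns))"

lemma scan_eq: "scan m P n = (tilde_state m n, filter (\<lambda>i. P (tilde_state m i)) (rev [0..<n]))"
  by (induction n) (simp_all add: tilde_state_def)

lemma tilde_Suc:
  assumes "n \<ge> 1"
  shows "a_tilde (Suc n) = 2 * a_tilde n + 3 * b_tilde n"
    and "b_tilde (Suc n) = a_tilde n + 2 * b_tilde n"
  using assms by (cases n; simp)+

lemma tilde_step_mod:
  "tilde_step m (a mod m, b mod m) = ((2 * a + 3 * b) mod m, (a + 2 * b) mod m)"
  unfolding tilde_step_def by (auto intro!: mod_add_cong mod_mult_cong)

lemma tilde_state_tilde:
  assumes "n \<ge> 1"
  shows "tilde_state m n = (a_tilde n mod m, b_tilde n mod m)"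
  using assms
proof (induction n rule: dec_induct)
  case base
  show ?case using tilde_step_mod[of m "- 5" 5] by (simp add: tilde_state_def)
next
  case (step n)
  have "tilde_state m (Suc n) = tilde_step m (tilde_state m n)"
    by (simp add: tilde_state_def)
  then show ?case
    using step by (simp add: tilde_step_mod tilde_Suc)
qed

lemma tilde_state_mod:
  assumes "tilde_state m N = tilde_state m 0"
  shows "tilde_state m (n mod N) = tilde_state m n"
  using assms by (simp add: tilde_state_def funpow_mod_eq)

text \<open>One evaluation of \<open>scan\<close> serves twice: its first component certifies that
  \<open>N\<close> is a period, its second lists the good residues. As \<open>n mod N\<close> can be
  0, level 0 has to carry a genuine value of the recurrence.\<close>

lemma scan_periodic:
  assumes "fst (scan m P N) = tilde_state m 0" and "N > 0" and "n \<ge> 1"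
  shows "P (a_tilde n mod m, b_tilde n mod m) \<longleftrightarrow> n mod N \<in> set (snd (scan m P N))"
proof -
  have "tilde_state m N = tilde_state m 0"
    using assms(1) by (simp add: scan_eq)
  then have "P (a_tilde n mod m, b_tilde n mod m) \<longleftrightarrow> P (tilde_state m (n mod N))"
    using \<open>n \<ge> 1\<close> by (simp add: tilde_state_mod tilde_state_tilde)
  then show ?thesis
    using \<open>N > 0\<close> by (simp add: scan_eq)
qed

text \<open>Entries are \<open>(q, period, residues of the solvable levels)\<close>.\<close>

definition table_a :: "(int \<times> nat \<times> nat list) list" where
  "table_a = [(5, 6, [4, 2, 0]), (6, 12, []), (7, 8, []), (8, 24, []), (9, 72, []), (10, 8, []),
   (11, 90, []), (12, 12, []), (13, 60, []), (14, 24, []), (15, 12, []), (16, 16, []),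
   (17, 18, []), (18, 144, []), (19, 90, [78, 58]), (20, 36, []), (21, 120, []), (22, 20, []),
   (23, 264, [204, 116, 28]), (24, 120, []), (25, 33, [32])]"

definition table_b :: "(int \<times> nat \<times> nat list) list" where
  "table_b = [(5, 1, [0]), (6, 6, []), (7, 8, []), (8, 4, []), (9, 18, [14, 5]), (10, 1, []),
   (11, 10, [8, 3]), (12, 12, []), (13, 12, []), (14, 8, []), (15, 6, [5, 2]), (16, 8, []),
   (17, 18, [14, 5]), (18, 18, []), (19, 5, []), (20, 4, []), (21, 24, []), (22, 10, []),
   (23, 11, []), (24, 12, []), (25, 3, [])]"

section \<open>Divisibility in terms of residue classes of the level\<close>

text \<open>The modulus is q(q - 2) because a_2 + q = q(q - 2)(p - 2).\<close>

lemma table_a_correct: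
  "list_all (\<lambda>(q, N, ns). N > 0 \<and>
     scan (q * (q - 2)) (\<lambda>(a, b). (a + q) mod (q * (q - 2)) = 0) N =
       ((- 5 mod (q * (q - 2)), 5 mod (q * (q - 2))), ns)) table_a"
  by code_simp

lemma table_b_correct:
  "list_all (\<lambda>(q, N, ns). N > 0 \<and>
     scan q (\<lambda>(a, b). b = 0) N = ((- 5 mod q, 5 mod q), ns)) table_b"
  by code_simp

lemma dvd_a_tilde_iff:
  assumes "5 \<le> q" "q \<le> 25" "l \<ge> 1"
  shows "q * (q - 2) dvd a_tilde l + q \<longleftrightarrow>
    q = 5 \<and> l mod 2 = 0 \<or> q = 19 \<and> l mod 90 \<in> {58, 78} \<or>
    q = 23 \<and> l mod 88 = 28 \<or> q = 25 \<and> l mod 33 = 32"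
proof -
  have "map fst table_a = [5..25]"
    by code_simp
  then have "q \<in> fst ` set table_a"
    using assms by (metis atLeastAtMost_iff set_map set_upto)
  then obtain N ns where mem: "(q, N, ns) \<in> set table_a"
    by auto
  then have "N > 0" and scan: "scan (q * (q - 2)) (\<lambda>(a, b). (a + q) mod (q * (q - 2)) = 0) N =
       ((- 5 mod (q * (q - 2)), 5 mod (q * (q - 2))), ns)"
    using table_a_correct by (auto simp: list_all_iff)
  have dvd_iff: "q * (q - 2) dvd a_tilde l + q \<longleftrightarrow> l mod N \<in> set ns"
    using scan_periodic[of "q * (q - 2)" "\<lambda>(a, b). (a + q) mod (q * (q - 2)) = 0" N l]
      scan \<open>N > 0\<close> \<open>l \<ge> 1\<close>
    by (simp add: tilde_state_def dvd_eq_mod_eq_0 mod_add_left_eq)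
  \<comment> \<open>For q = 5 the state modulo 15 is tabulated with period 6, but the good residues
    are exactly the even ones.\<close>
  have mod_6: "l mod 6 \<in> set [4, 2, 0] \<longleftrightarrow> l mod 2 = 0"
    by simp presburger
  \<comment> \<open>The residues 28, 116 and 204 differ by multiples of 88, and 264 = 3 * 88, so
    they merge into one class modulo 88.\<close>
  have mod_264: "l mod 264 \<in> set [204, 116, 28] \<longleftrightarrow> l mod 88 = 28"
  proof -
    define d r where "d = l div 88 mod 3" and "r = l mod 88"
    then have l: "l mod 264 = 88 * d + r" and "r < 88"
      using mod_mult2_eq[of l 88 3] by simp_all
    have "d = 0 \<or> d = 1 \<or> d = 2"
      unfolding d_def by linarith
    then have "88 * d + r \<in> set [204, 116, 28] \<longleftrightarrow> r = 28"
      using \<open>r < 88\<close> by auto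
    then show ?thesis
      unfolding l r_def .
  qed
  \<comment> \<open>The 21 rows collapse to four with solutions and one common shape without
    any.\<close>
  have "list_all (\<lambda>(q, N, ns). q = 5 \<and> N = 6 \<and> ns = [4, 2, 0] \<or> q = 19 \<and> N = 90 \<and> ns = [78, 58] \<or>
      q = 23 \<and> N = 264 \<and> ns = [204, 116, 28] \<or> q = 25 \<and> N = 33 \<and> ns = [32] \<or>
      q \<notin> {5, 19, 23, 25} \<and> ns = []) table_a"
    by code_simp
  from this[unfolded list_all_iff, THEN bspec, OF mem, unfolded prod.case] show ?thesis
    unfolding dvd_iff by (elim disjE conjE; hypsubst; (simp only: mod_6 mod_264)?; auto)
qed

text \<open>Modulo 5 the state is (0, 0) at every level, so q = 5 comes with no condition on
  \<open>l\<close>.\<close>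

lemma dvd_b_tilde_iff:
  assumes "5 \<le> q" "q \<le> 25" "l \<ge> 1"
  shows "q dvd b_tilde l \<longleftrightarrow>
    q = 5 \<or> q \<in> {9, 17} \<and> l mod 18 \<in> {5, 14} \<or>
    q = 11 \<and> l mod 10 \<in> {3, 8} \<or> q = 15 \<and> l mod 6 \<in> {2, 5}"
proof -
  have "map fst table_b = [5..25]"
    by code_simp
  then have "q \<in> fst ` set table_b"
    using assms by (metis atLeastAtMost_iff set_map set_upto)
  then obtain N ns where mem: "(q, N, ns) \<in> set table_b"
    by auto
  then have "N > 0" and scan: "scan q (\<lambda>(a, b). b = 0) N = ((- 5 mod q, 5 mod q), ns)"
    using table_b_correct by (auto simp: list_all_iff)
  have dvd_iff: "q dvd b_tilde l \<longleftrightarrow> l mod N \<in> set ns"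
    using scan_periodic[of _ "\<lambda>(a, b). b = 0" N l] scan \<open>N > 0\<close> \<open>l \<ge> 1\<close>
    by (simp add: tilde_state_def dvd_eq_mod_eq_0)
  have "list_all (\<lambda>(q, N, ns). q = 5 \<and> N = 1 \<and> ns = [0] \<or>
      (q = 9 \<or> q = 17) \<and> N = 18 \<and> ns = [14, 5] \<or> q = 11 \<and> N = 10 \<and> ns = [8, 3] \<or>
      q = 15 \<and> N = 6 \<and> ns = [5, 2] \<or> q \<notin> {5, 9, 11, 15, 17} \<and> ns = []) table_b"
    by code_simp
  from this[unfolded list_all_iff, THEN bspec, OF mem, unfolded prod.case] show ?thesis
    unfolding dvd_iff by (elim disjE conjE; hypsubst; auto)
qed

section \<open>Growth and the size of p\<close>

text \<open>The coefficients in \<open>tilde_Suc\<close> sum to 5 and to 3, so a common lower bound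
  at least triples at each level. Each recurrence involves both sequences, hence the joint
  induction.\<close>

lemma tilde_ge:
  assumes "1 \<le> k" "k \<le> l"
  shows "5 * 3 ^ (k - 1) \<le> a_tilde l" "5 * 3 ^ (k - 1) \<le> b_tilde l"
proof -
  have "5 * 3 ^ (l - 1) \<le> a_tilde l \<and> 5 * 3 ^ (l - 1) \<le> b_tilde l"
    using order_trans[OF assms]
  proof (induction l rule: dec_induct)
    case base
    show ?case by simp
  next
    case (step n)
    then have "(3::int) ^ n = 3 * 3 ^ (n - 1)"
      by (simp flip: power_Suc)
    moreover have "(0::int) < 3 ^ (n - 1)"
      by simp
    ultimately show ?case
      using step unfolding tilde_Suc[OF step(1)] diff_Suc_1 by (intro conjI; linarith)
  qed
  moreover have "(3::int) ^ (k - 1) \<le> 3 ^ (l - 1)"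
    using assms by (intro power_increasing) auto
  ultimately show "5 * 3 ^ (k - 1) \<le> a_tilde l" "5 * 3 ^ (k - 1) \<le> b_tilde l"
    by linarith+
qed

text \<open>The quotient of x + q by q(q - 2) is p - 2, which is at least 2. The pair (5, 25) stands
  for the excluded mosaic {4,5}.\<close>

lemma mosaic_a_2_solvable_iff:
  assumes "q \<ge> 5"
  shows "(\<exists>p. admissible p q \<and> mosaic_a p q 2 = x) \<longleftrightarrow>
    q * (q - 2) dvd x + q \<and> 2 * (q * (q - 2)) \<le> x + q \<and> (q, x) \<noteq> (5, 25)"
proof
  assume "\<exists>p. admissible p q \<and> mosaic_a p q 2 = x"
  then obtain p where p: "4 \<le> p" "(p, q) \<noteq> (4, 5)" "x + q = q * (q - 2) * (p - 2)"
    by (auto simp: admissible_def mosaic_a_2)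
  have "q * (q - 2) * 2 \<le> q * (q - 2) * (p - 2)"
    using p(1) assms by (intro mult_left_mono) auto
  then show "q * (q - 2) dvd x + q \<and> 2 * (q * (q - 2)) \<le> x + q \<and> (q, x) \<noteq> (5, 25)"
    using p by auto
next
  assume R: "q * (q - 2) dvd x + q \<and> 2 * (q * (q - 2)) \<le> x + q \<and> (q, x) \<noteq> (5, 25)"
  then obtain c where c: "x + q = q * (q - 2) * c"
    by (auto elim: dvdE)
  have "q * (q - 2) > 0"
    using assms by simp
  with R c have "2 \<le> c"
    by (metis mult.commute mult_le_cancel_left_pos)
  moreover have "(c, q) \<noteq> (2, 5)"
    using R c by auto
  ultimately have "admissible (c + 2) q \<and> mosaic_a (c + 2) q 2 = x"
    using c assms by (auto simp: admissible_def mosaic_a_2)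
  then show "\<exists>p. admissible p q \<and> mosaic_a p q 2 = x"
    by blast
qed

text \<open>Here the quotient of x by q is p - 3, which is at least 1; (5, 5) again stands for
  {4,5}.\<close>

lemma mosaic_b_1_solvable_iff:
  assumes "q \<ge> 5"
  shows "(\<exists>p. admissible p q \<and> mosaic_b p q 1 = x) \<longleftrightarrow>
    q dvd x \<and> q \<le> x \<and> (q, x) \<noteq> (5, 5)"
proof
  assume "\<exists>p. admissible p q \<and> mosaic_b p q 1 = x"
  then obtain p where p: "4 \<le> p" "(p, q) \<noteq> (4, 5)" "x = q * (p - 3)"
    by (auto simp: admissible_def)
  have "q * 1 \<le> q * (p - 3)"
    using p(1) assms by (intro mult_left_mono) auto
  then show "q dvd x \<and> q \<le> x \<and> (q, x) \<noteq> (5, 5)"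
    using p by auto
next
  assume R: "q dvd x \<and> q \<le> x \<and> (q, x) \<noteq> (5, 5)"
  then obtain c where c: "x = q * c"
    by (auto elim: dvdE)
  with R assms have "1 \<le> c"
    by (metis mult.right_neutral mult_le_cancel_left_pos less_le_trans zero_less_numeral)
  moreover have "(c, q) \<noteq> (1, 5)"
    using R c by auto
  ultimately have "admissible (c + 3) q \<and> mosaic_b (c + 3) q 1 = x"
    using c assms by (auto simp: admissible_def)
  then show "\<exists>p. admissible p q \<and> mosaic_b p q 1 = x"
    by blast
qed

lemma a_tilde_solvable_iff:
  "5 \<le> q \<and> q \<le> 25 \<and> 1 \<le> l \<and> (\<exists>p. admissible p q \<and> mosaic_a p q 2 = a_tilde l) \<longleftrightarrow>
    q = 5 \<and> l mod 2 = 0 \<and> l > 2 \<or> q = 19 \<and> l mod 90 \<in> {58, 78} \<or>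
    q = 23 \<and> l mod 88 = 28 \<or> q = 25 \<and> l mod 33 = 32"
proof (cases "5 \<le> q \<and> q \<le> 25 \<and> 1 \<le> l")
  case True
  then have range: "5 \<le> q" "q \<le> 25" "1 \<le> l"
    by auto
  \<comment> \<open>10935 = 5 * 3^7 exceeds the largest size requirement, 2 * 25 * 23 - 25 = 1125 at
    q = 25.\<close>
  have large: "10935 \<le> a_tilde l" if "l mod N \<in> {28, 32, 58, 78}" for N
  proof -
    have "8 \<le> l"
      using that mod_less_eq_dividend[of l N] by (auto simp del: mod_less_eq_dividend)
    then show ?thesis
      using tilde_ge(1)[of 8 l] by simp
  qed
  \<comment> \<open>For q = 5 the size requirement is 25. Level 2 attains it, but with the excluded
    p = 4; later levels exceed it.\<close>
  have "45 \<le> a_tilde l" if "l > 2"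
    using tilde_ge(1)[of 3 l] that by simp
  moreover have "a_tilde l = 25" if "l = 2"
    using that by (simp add: numeral_2_eq_2)
  moreover have "l = 2 \<or> l > 2" if "l mod 2 = 0"
    using that range by presburger
  ultimately show ?thesis
    unfolding mosaic_a_2_solvable_iff[OF range(1)] dvd_a_tilde_iff[OF range]
    using large[of 90] large[of 88] large[of 33] by auto
next
  case False
  then show ?thesis
    by (cases "l = 0") auto
qed

lemma b_tilde_solvable_iff:
  "5 \<le> q \<and> q \<le> 25 \<and> 1 \<le> l \<and> (\<exists>p. admissible p q \<and> mosaic_b p q 1 = b_tilde l) \<longleftrightarrow>
    q = 5 \<and> l \<ge> 2 \<or> q \<in> {9, 17} \<and> l mod 18 \<in> {5, 14} \<or>
    q = 11 \<and> l mod 10 \<in> {3, 8} \<or> q = 15 \<and> l mod 6 \<in> {2, 5}"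
proof (cases "5 \<le> q \<and> q \<le> 25 \<and> 1 \<le> l")
  case True
  then have range: "5 \<le> q" "q \<le> 25" "1 \<le> l"
    by auto
  \<comment> \<open>This is sharp for q = 15: level 2 has value 15, which gives p = 4.\<close>
  have "15 \<le> b_tilde l" if "l \<ge> 2"
    using tilde_ge(2)[of 2 l] that by simp
  \<comment> \<open>45 = 5 * 3^2 is above 17, the largest solvable q.\<close>
  moreover have "45 \<le> b_tilde l" if "l mod N \<in> {3, 5, 8, 14}" for N
  proof -
    have "3 \<le> l"
      using that mod_less_eq_dividend[of l N] by (auto simp del: mod_less_eq_dividend)
    then show ?thesis
      using tilde_ge(2)[of 3 l] by simp
  qed
  note this[of 18] this[of 10] this[of 6]
  moreover have "l \<ge> 2" if "l mod 6 = 2"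
    using that mod_less_eq_dividend[of l 6] by linarith
  moreover have "b_tilde l = 5" if "\<not> l \<ge> 2"
  proof -
    have "l = Suc 0"
      using that range by simp
    then show ?thesis
      by simp
  qed
  ultimately show ?thesis
    unfolding mosaic_b_1_solvable_iff[OF range(1)] dvd_b_tilde_iff[OF range]
    by auto
next
  case False
  then show ?thesis
    by (cases "l = 0") auto
qed

section \<open>From residue classes to arithmetic progressions\<close>

lemma mem_progression_iff:
  fixes l r N :: nat
  assumes "r < N"
  shows "(q, l) \<in> {(c, r + N * t) | t. True} \<longleftrightarrow> q = c \<and> l mod N = r"
proof -
  have "(\<exists>t. l = r + N * t) \<longleftrightarrow> l mod N = r"
    using assms by (metis mod_less mod_mult_self2 mult_div_mod_eq add.commute)
  then show ?thesis
    by auto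
qed

lemma Uniq_preimage:
  assumes "inj f"
  shows "\<exists>\<^sub>\<le>\<^sub>1 x. P x \<and> f x = c"
  using assms unfolding Uniq_def by (metis injD)

text \<open>The second equation also has a family with q = 5, since 5 divides every term of
  \<open>b_tilde\<close>; only level 1 drops out, as it would give {4,5}.\<close>

theorem theorem3:
  "({(q :: int, l :: nat). 5 \<le> q \<and> q \<le> 25 \<and> 1 \<le> l \<and>
        (\<exists>p. admissible p q \<and> mosaic_a p q 2 = a_tilde l)}
     = {(5, 2 + 2 * t) | t. 1 \<le> t}
       \<union> {(19, 58 + 90 * t) | t. True} \<union> {(19, 78 + 90 * t) | t. True}
       \<union> {(23, 28 + 88 * t) | t. True}
       \<union> {(25, 32 + 33 * t) | t. True})
   \<and> (\<forall>(q :: int) (l :: nat). 5 \<le> q \<and> q \<le> 25 \<and> 1 \<le> l \<longrightarrow>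
        (\<exists>\<^sub>\<le>\<^sub>1 p. admissible p q \<and> mosaic_a p q 2 = a_tilde l))
   \<and> ({(q :: int, l :: nat). 5 \<le> q \<and> q \<le> 25 \<and> 1 \<le> l \<and>
        (\<exists>p. admissible p q \<and> mosaic_b p q 1 = b_tilde l)}
     = {(5, 2 + t) | t. True}
       \<union> {(9, 5 + 18 * t) | t. True} \<union> {(9, 14 + 18 * t) | t. True}
       \<union> {(11, 3 + 10 * t) | t. True} \<union> {(11, 8 + 10 * t) | t. True}
       \<union> {(15, 2 + 6 * t) | t. True} \<union> {(15, 5 + 6 * t) | t. True}
       \<union> {(17, 5 + 18 * t) | t. True} \<union> {(17, 14 + 18 * t) | t. True})
   \<and> (\<forall>(q :: int) (l :: nat). 5 \<le> q \<and> q \<le> 25 \<and> 1 \<le> l \<longrightarrow>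
        (\<exists>\<^sub>\<le>\<^sub>1 p. admissible p q \<and> mosaic_b p q 1 = b_tilde l))"
proof (intro conjI allI impI, goal_cases)
  case 1
  \<comment> \<open>Starting at t = 1 removes level 2, where p would be 4.\<close>
  have five: "(q, l) \<in> {(5, 2 + 2 * t) | t. 1 \<le> t} \<longleftrightarrow> q = 5 \<and> l mod 2 = 0 \<and> l > 2"
    for q :: int and l :: nat
    by simp presburger
  show ?case (is "?L = ?R")
  proof (rule set_eqI, clarify)
    fix q :: int and l :: nat
    have "(q, l) \<in> ?R \<longleftrightarrow> q = 5 \<and> l mod 2 = 0 \<and> l > 2 \<or> q = 19 \<and> l mod 90 \<in> {58, 78} \<or>
        q = 23 \<and> l mod 88 = 28 \<or> q = 25 \<and> l mod 33 = 32"
      by (simp only: Un_iff mem_progression_iff five rel_simps) blast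
    then show "(q, l) \<in> ?L \<longleftrightarrow> (q, l) \<in> ?R"
      unfolding mem_Collect_eq case_prod_conv a_tilde_solvable_iff by (rule sym)
  qed
next
  case (2 q l)
  \<comment> \<open>\<open>mosaic_a p q 2\<close> is affine in p with slope q(q - 2), nonzero for q
    at least 5.\<close>
  then have "inj (\<lambda>p. mosaic_a p q 2)"
    by (simp add: inj_def mosaic_a_2)
  then show ?case
    by (rule Uniq_preimage)
next
  case 3
  have five: "(q, l) \<in> {(5, 2 + t) | t. True} \<longleftrightarrow> q = 5 \<and> l \<ge> 2"
    for q :: int and l :: nat
    by simp presburger
  show ?case (is "?L = ?R")
  proof (rule set_eqI, clarify)
    fix q :: int and l :: nat
    have "(q, l) \<in> ?R \<longleftrightarrow> q = 5 \<and> l \<ge> 2 \<or> q \<in> {9, 17} \<and> l mod 18 \<in> {5, 14} \<or>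
        q = 11 \<and> l mod 10 \<in> {3, 8} \<or> q = 15 \<and> l mod 6 \<in> {2, 5}"
      by (simp only: Un_iff mem_progression_iff five rel_simps) blast
    then show "(q, l) \<in> ?L \<longleftrightarrow> (q, l) \<in> ?R"
      unfolding mem_Collect_eq case_prod_conv b_tilde_solvable_iff by (rule sym)
  qed
next
  case (4 q l)
  then have "inj (\<lambda>p. mosaic_b p q 1)"
    by (simp add: inj_def)
  then show ?case
    by (rule Uniq_preimage)
qed

end
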